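(* There is an orientation of the $H_{15}$-replacement of the graph $\mathrm{TC}$ that yields a cubic graph on $450$ vertices with no cycle of length $4$, $8$, $16$ or $32$. Hence $f(5)\le 450$.
   Context: Graphs are finite, simple and undirected; cycles are simple. $f(k)$ denotes the order (number of vertices) of a smallest cubic graph with no cycle of length $2^m$ for any $m\le k$. $\mathrm{TC}$ (the Tutte–Coxeter graph) is the cubic graph with vertex set $\{0,1,\dots,29\}$ whose edges are the outer edges $\{i,i+1\}$ for $i=0,\dots,29$ (indices mod $30$) and the fifteen chords $\{29+6t,12+6t\}$, $\{28+6t,7+6t\}$, $\{26+6t,3+6t\}$ for $t=0,\dots,4$ (indices mod $30$). Gadgets: $H_7$ is the graph with vertices $u,v,w,a,b,c,d$ and edges $va,ab,bw,cv,wd,ac,cu,ud,db$. $H_{15}$ consists of two disjoint copies $A,B$ of $H_7$ (with vertices subscripted by $A$ or $B$) and one further vertex $z$, with the additional edges $v_Av_B$, $w_Az$, $zw_B$; its three attachments (its vertices of degree $2$) are named $u=z$, $v=u_B$, $w=u_A$. The $H_{15}$-replacement of a cubic graph: take disjoint copies of $H_{15}$, one for each vertex $x$; for each $x$ choose a bijection between the three edges at $x$ and the three attachments of its copy; for each edge $xy$ add an edge joining the attachment of the copy of $x$ assigned to $xy$ to the attachment of the copy of $y$ assigned to $xy$. An orientation is the choice, for each vertex $x$, of which incident edge is assigned to the attachment $u$ (the order in which the other two edges are assigned to $v$ and $w$ does not affect the isomorphism type, as $H_{15}$ has an automorphism fixing $u$ and exchanging $v$ and $w$). *)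

theory Defs
  imports Main
begin

section \<open>Finite simple graphs\<close>

record 'a graph =
  verts :: "'a set"
  edges :: "'a set set"

definition simple_graph :: "'a graph \<Rightarrow> bool" where
  "simple_graph G \<longleftrightarrow> finite (verts G) \<and> (\<forall>e \<in> edges G. e \<subseteq> verts G \<and> card e = 2)"

definition incident :: "'a graph \<Rightarrow> 'a \<Rightarrow> 'a set set" where
  "incident G x = {e \<in> edges G. x \<in> e}"

definition degree :: "'a graph \<Rightarrow> 'a \<Rightarrow> nat" where
  "degree G x = card (incident G x)"

definition cubic :: "'a graph \<Rightarrow> bool" where
  "cubic G \<longleftrightarrow> simple_graph G \<and> (\<forall>x \<in> verts G. degree G x = 3)"

text \<open>A simple cycle is given by the list of its vertices in cyclic order.\<close>

definition is_cycle :: "'a graph \<Rightarrow> 'a list \<Rightarrow> bool" where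
  "is_cycle G c \<longleftrightarrow> 3 \<le> length c \<and> distinct c \<and> set c \<subseteq> verts G \<and>
     (\<forall>i < length c. {c ! i, c ! (Suc i mod length c)} \<in> edges G)"

definition has_cycle_of_length :: "'a graph \<Rightarrow> nat \<Rightarrow> bool" where
  "has_cycle_of_length G n \<longleftrightarrow> (\<exists>c. is_cycle G c \<and> length c = n)"

text \<open>The function called \<open>f\<close> in the literature. Taking vertices in \<open>nat\<close> loses no generality,
  since all graphs here are finite. The empty graph, which is vacuously cubic, has to be excluded.\<close>

definition smallest_order :: "nat \<Rightarrow> nat" where
  "smallest_order k = (LEAST n. \<exists>G :: nat graph. cubic G \<and> verts G \<noteq> {} \<and> card (verts G) = n \<and>
     (\<forall>m \<le> k. \<not> has_cycle_of_length G (2 ^ m)))"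

section \<open>The Tutte--Coxeter graph\<close>

definition TC :: "nat graph" where
  "TC = \<lparr> verts = {0..<30},
     edges = {{i, (i + 1) mod 30} | i. i < 30}
       \<union> {{(29 + 6 * t) mod 30, (12 + 6 * t) mod 30} | t. t < 5}
       \<union> {{(28 + 6 * t) mod 30, (7 + 6 * t) mod 30} | t. t < 5}
       \<union> {{(26 + 6 * t) mod 30, (3 + 6 * t) mod 30} | t. t < 5} \<rparr>"

section \<open>The gadgets\<close>

datatype h7 = u7 | v7 | w7 | a7 | b7 | c7 | d7

definition H7 :: "h7 graph" where
  "H7 = \<lparr> verts = {u7, v7, w7, a7, b7, c7, d7},
     edges = {{v7, a7}, {a7, b7}, {b7, w7}, {c7, v7}, {w7, d7},
              {a7, c7}, {c7, u7}, {u7, d7}, {d7, b7}} \<rparr>"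

datatype h15 = A h7 | B h7 | Z

definition H15 :: "h15 graph" where
  "H15 = \<lparr> verts = A ` verts H7 \<union> B ` verts H7 \<union> {Z},
     edges = (\<lambda>e. A ` e) ` edges H7 \<union> (\<lambda>e. B ` e) ` edges H7
       \<union> {{A v7, B v7}, {A w7, Z}, {Z, B w7}} \<rparr>"

definition att_u :: h15 where "att_u = Z"
definition att_v :: h15 where "att_v = B u7"
definition att_w :: h15 where "att_w = A u7"

section \<open>Replacing the vertices of a cubic graph by copies of \<open>H15\<close>\<close>

text \<open>\<open>\<beta> x e\<close> is the attachment, in the copy of \<open>H15\<close> at \<open>x\<close>, assigned to the edge \<open>e\<close> at \<open>x\<close>.\<close>

definition assignment :: "'a graph \<Rightarrow> ('a \<Rightarrow> 'a set \<Rightarrow> h15) \<Rightarrow> bool" where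
  "assignment G \<beta> \<longleftrightarrow> (\<forall>x \<in> verts G. bij_betw (\<beta> x) (incident G x) {att_u, att_v, att_w})"

definition H15_replacement :: "'a graph \<Rightarrow> ('a \<Rightarrow> 'a set \<Rightarrow> h15) \<Rightarrow> ('a \<times> h15) graph" where
  "H15_replacement G \<beta> = \<lparr> verts = verts G \<times> verts H15,
     edges = {{(x, p), (x, q)} | x p q. x \<in> verts G \<and> {p, q} \<in> edges H15}
       \<union> {{(x, \<beta> x {x, y}), (y, \<beta> y {x, y})} | x y. {x, y} \<in> edges G} \<rparr>"

text \<open>An orientation \<open>\<omega>\<close> only records the edge assigned to \<open>u\<close>. Each orientation of a
  cubic graph is realised by some assignment (\<open>ex_assignment\<close>); all of these give isomorphic
  replacements, because \<open>H15\<close> has an automorphism fixing \<open>u\<close> and exchanging \<open>v\<close> and \<open>w\<close>.\<close>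

definition orientation :: "'a graph \<Rightarrow> ('a \<Rightarrow> 'a set) \<Rightarrow> bool" where
  "orientation G \<omega> \<longleftrightarrow> (\<forall>x \<in> verts G. \<omega> x \<in> incident G x)"

definition realises :: "'a graph \<Rightarrow> ('a \<Rightarrow> 'a set \<Rightarrow> h15) \<Rightarrow> ('a \<Rightarrow> 'a set) \<Rightarrow> bool" where
  "realises G \<beta> \<omega> \<longleftrightarrow> assignment G \<beta> \<and> (\<forall>x \<in> verts G. \<beta> x (\<omega> x) = att_u)"

lemma ex_assignment:
  assumes "cubic G" and "orientation G \<omega>"
  shows "\<exists>\<beta>. realises G \<beta> \<omega>"
proof -
  have "\<exists>b. bij_betw b (incident G x) {att_u, att_v, att_w} \<and> b (\<omega> x) = att_u"
    if x: "x \<in> verts G" for x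
  proof -
    have w: "\<omega> x \<in> incident G x" and c: "card (incident G x) = 3"
      using assms x by (auto simp: orientation_def cubic_def degree_def)
    have fin: "finite (incident G x)"
      using c by (metis card.infinite zero_neq_numeral)
    have "card (incident G x - {\<omega> x}) = card {att_v, att_w}"
      using w c fin by (simp add: att_v_def att_w_def)
    then obtain b where b: "bij_betw b (incident G x - {\<omega> x}) {att_v, att_w}"
      using fin finite_same_card_bij[of "incident G x - {\<omega> x}" "{att_v, att_w}"] by auto
    have "bij_betw (b(\<omega> x := att_u)) (incident G x - {\<omega> x}) {att_v, att_w}"
      using b by (subst bij_betw_cong[where g = b]) auto
    then have "bij_betw (b(\<omega> x := att_u)) (incident G x - {\<omega> x} \<union> {\<omega> x}) ({att_v, att_w} \<union> {att_u})"
      by (rule bij_betw_combine) (auto simp: att_u_def att_v_def att_w_def)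
    moreover have "incident G x - {\<omega> x} \<union> {\<omega> x} = incident G x"
      using w by auto
    moreover have "{att_v, att_w} \<union> {att_u} = {att_u, att_v, att_w}"
      by auto
    ultimately show ?thesis
      by (metis fun_upd_same)
  qed
  then show ?thesis
    unfolding realises_def assignment_def by metis
qed

end

theory Submission
  imports Defs
begin

text \<open>
  Orient \<open>TC\<close> along its Hamiltonian cycle \<open>0, 1, \<dots>, 29\<close>: the edge assigned to \<open>u\<close> at \<open>x\<close> is the one
  to \<open>x + 1\<close>. A cycle of the replacement either stays in one copy of \<open>H15\<close>, where a finite
  search excludes the lengths 4 and 8, or it projects to a closed reduced walk in \<open>TC\<close>. Two distinct
  attachments of \<open>H15\<close> have distance at least 3, and at least 4 if neither is \<open>u\<close>; so each passage
  through a copy uses at least 4 vertices, and exactly 4 only if the attachment \<open>u\<close> is used. As \<open>TC\<close>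
  has girth 8, a cycle of length at most 32 has length exactly 32 and projects to a closed walk of
  length 8 all of whose passages use \<open>u\<close>. The vertices of such a walk are closed under
  \<open>x \<mapsto> x + 1\<close>, so there are 30 of them, which is absurd.
\<close>

section \<open>Graphs and walks\<close>

definition nbrs :: "'a graph \<Rightarrow> 'a \<Rightarrow> 'a set" where
  "nbrs G x = {y. {x, y} \<in> edges G}"

lemma edge_in_verts:
  assumes "simple_graph G" "{x, y} \<in> edges G"
  shows "x \<in> verts G" "y \<in> verts G" "x \<noteq> y"
  using assms by (auto simp: simple_graph_def card_insert_if split: if_splits)

lemma incident_eq_image_nbrs:
  assumes "simple_graph G"
  shows "incident G x = (\<lambda>y. {x, y}) ` nbrs G x"
proof -
  have "\<exists>y. e = {x, y}" if "e \<in> edges G" "x \<in> e" for e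
  proof -
    have "card e = 2" using assms that by (auto simp: simple_graph_def)
    then show ?thesis using that by (auto simp: card_2_iff)
  qed
  then show ?thesis by (fastforce simp: incident_def nbrs_def)
qed

lemma degree_eq_card_nbrs:
  assumes "simple_graph G"
  shows "degree G x = card (nbrs G x)"
proof -
  have "inj_on (\<lambda>y. {x, y}) (nbrs G x)"
    by (auto simp: inj_on_def doubleton_eq_iff)
  then show ?thesis
    by (simp add: degree_def incident_eq_image_nbrs[OF assms] card_image)
qed

section \<open>Transport of graphs along injective maps\<close>

definition map_graph :: "('a \<Rightarrow> 'b) \<Rightarrow> 'a graph \<Rightarrow> 'b graph" where
  "map_graph f G = \<lparr>verts = f ` verts G, edges = (`) f ` edges G\<rparr>"

text \<open>Edges are subsets of \<open>verts G\<close>, where \<open>f\<close> is injective, so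
  distinct edges have distinct images.\<close>

lemma edge_map_graph:
  assumes "simple_graph G" "inj_on f (verts G)" "x \<in> verts G" "y \<in> verts G"
  shows "{f x, f y} \<in> edges (map_graph f G) \<longleftrightarrow> {x, y} \<in> edges G"
proof -
  have "{x, y} = e" if "f ` {x, y} = f ` e" "e \<in> edges G" for e
    using that assms inj_on_image_eq_iff[of f "verts G" "{x, y}" e] by (auto simp: simple_graph_def)
  then show ?thesis
    by (auto simp: map_graph_def image_iff) (metis image_empty image_insert)
qed

lemma cubic_map_graph:
  assumes "cubic G" "inj_on f (verts G)"
  shows "cubic (map_graph f G)"
proof -
  have sG: "simple_graph G" using assms by (simp add: cubic_def)
  have card_f: "card (f ` e) = 2" if "e \<in> edges G" for e
    using that sG assms(2) by (metis card_image inj_on_subset simple_graph_def)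
  have s: "simple_graph (map_graph f G)"
    using sG card_f by (auto simp: simple_graph_def map_graph_def)
  moreover have "degree (map_graph f G) (f x) = 3" if x: "x \<in> verts G" for x
  proof -
    have N: "nbrs (map_graph f G) (f x) = f ` nbrs G x"
    proof -
      have "nbrs (map_graph f G) (f x) \<subseteq> f ` verts G"
        using edge_in_verts(2)[OF s] by (auto simp: nbrs_def map_graph_def)
      moreover have "nbrs G x \<subseteq> verts G"
        using edge_in_verts(2)[OF sG] by (auto simp: nbrs_def)
      ultimately show ?thesis
        using edge_map_graph[OF sG assms(2) x] by (fastforce simp: nbrs_def)
    qed
    have "nbrs G x \<subseteq> verts G"
      using edge_in_verts(2)[OF sG] by (auto simp: nbrs_def)
    then have "card (f ` nbrs G x) = card (nbrs G x)"
      by (metis assms(2) card_image inj_on_subset)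
    then show ?thesis
      using assms(1) x by (simp add: degree_eq_card_nbrs s sG N cubic_def)
  qed
  ultimately show ?thesis by (auto simp: cubic_def map_graph_def)
qed

lemma has_cycle_of_length_map_graph:
  assumes "simple_graph G" "inj_on f (verts G)" "has_cycle_of_length (map_graph f G) n"
  shows "has_cycle_of_length G n"
proof -
  obtain c where c: "is_cycle (map_graph f G) c" "length c = n"
    using assms(3) by (auto simp: has_cycle_of_length_def)
  then have "set c \<subseteq> f ` verts G" by (auto simp: is_cycle_def map_graph_def)
  then have "c \<in> map f ` lists (verts G)"
    by (simp add: lists_image[symmetric] in_lists_conv_set subset_iff)
  then obtain d where d: "c = map f d" "set d \<subseteq> verts G"
    by auto
  have "{d ! i, d ! (Suc i mod length d)} \<in> edges G" if i: "i < length d" for i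
  proof -
    have j: "Suc i mod length d < length d" using i by (intro mod_less_divisor) auto
    have "{f (d ! i), f (d ! (Suc i mod length d))} \<in> edges (map_graph f G)"
      using c(1) i j d(1) by (auto simp: is_cycle_def)
    then show ?thesis
      using edge_map_graph[OF assms(1,2)] d(2) i j by (meson nth_mem subsetD)
  qed
  then have "is_cycle G d"
    using c(1) d by (auto simp: is_cycle_def distinct_map)
  then show ?thesis
    using c(2) d(1) by (auto simp: has_cycle_of_length_def)
qed

text \<open>\<open>smallest_order\<close> ranges over graphs on \<open>nat\<close> only; a finite
  graph on any type is carried there by an injection.\<close>

lemma smallest_order_le:
  assumes "cubic G" "verts G \<noteq> {}" "\<And>m. m \<le> k \<Longrightarrow> \<not> has_cycle_of_length G (2 ^ m)"
  shows "smallest_order k \<le> card (verts G)"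
proof -
  have s: "simple_graph G" and "finite (verts G)"
    using assms(1) by (auto simp: cubic_def simple_graph_def)
  then obtain f :: "'a \<Rightarrow> nat" where f: "inj_on f (verts G)"
    using finite_imp_inj_to_nat_seg by metis
  let ?H = "map_graph f G"
  have "cubic ?H" "verts ?H \<noteq> {}" "card (verts ?H) = card (verts G)"
    "\<forall>m\<le>k. \<not> has_cycle_of_length ?H (2 ^ m)"
    using assms cubic_map_graph[OF _ f] has_cycle_of_length_map_graph[OF s f] card_image[OF f]
    by (auto simp: map_graph_def)
  then show ?thesis
    unfolding smallest_order_def by (intro Least_le) blast
qed

section \<open>Walks as lists and exhaustive search\<close>

fun triples :: "('a \<Rightarrow> 'a \<Rightarrow> 'a \<Rightarrow> bool) \<Rightarrow> 'a list \<Rightarrow> bool" where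
  "triples P (x # y # z # r) = (P x y z \<and> triples P (y # z # r))"
| "triples P _ = True"

text \<open>Meant for closed walks written as \<open>last xs # xs @ [hd xs]\<close>: each entry of
  \<open>xs\<close> is then the middle of a triple whose outer entries lie in \<open>xs\<close>
  too.\<close>

lemma triples_midpoint:
  assumes "triples P (y # xs @ [z])" "x \<in> set xs"
  shows "\<exists>s\<in>set (y # xs). \<exists>r\<in>set (xs @ [z]). P s x r"
  using assms
proof (induction xs arbitrary: y)
  case (Cons a xs)
  show ?case
  proof (cases xs)
    case Nil
    then show ?thesis using Cons.prems by auto
  next
    case xs: (Cons b ys)
    then have "P y a b" "triples P (a # xs @ [z])" using Cons.prems by auto
    then show ?thesis using Cons.IH[of a] Cons.prems(2) xs by fastforce
  qed
qed auto

abbreviation reduced :: "'a list \<Rightarrow> bool" where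
  "reduced \<equiv> triples (\<lambda>x y z. x \<noteq> z)"

abbreviation walk :: "'a graph \<Rightarrow> 'a list \<Rightarrow> bool" where
  "walk G \<equiv> successively (\<lambda>x y. {x, y} \<in> edges G)"

lemma triples_nth:
  "triples P xs \<Longrightarrow> Suc (Suc i) < length xs \<Longrightarrow> P (xs ! i) (xs ! Suc i) (xs ! Suc (Suc i))"
proof (induction P xs arbitrary: i rule: triples.induct)
  case (1 P x y z r)
  then show ?case by (cases i) auto
qed auto

lemma triples_append1: "triples P (xs @ ys) \<Longrightarrow> triples P xs"
  by (induction P xs rule: triples.induct) auto

text \<open>Depth-first search; the path found so far is listed with its newest vertex first.\<close>

fun search :: "('a list \<Rightarrow> 'a list) \<Rightarrow> ('a list \<Rightarrow> bool) \<Rightarrow> nat \<Rightarrow> 'a list \<Rightarrow> bool" where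
  "search nxt ok 0 p = ok p"
| "search nxt ok (Suc n) p = list_ex (\<lambda>w. search nxt ok n (w # p)) (nxt p)"

text \<open>\<open>drop (Suc i) q\<close> is the path at the moment when \<open>q ! i\<close> is
  chosen, so the search succeeds along \<open>q\<close> itself. A failing search therefore refutes
  the existence of \<open>q\<close>.\<close>

lemma search_complete:
  assumes "ok q" and "\<And>i. i < n \<Longrightarrow> q ! i \<in> set (nxt (drop (Suc i) q))" and "n \<le> length q"
  shows "search nxt ok n (drop n q)"
proof -
  have "search nxt ok k (drop k q)" if "k \<le> n" for k
    using that
  proof (induction k)
    case 0
    then show ?case using assms(1) by simp
  next
    case (Suc k)
    have "drop k q = q ! k # drop (Suc k) q"
      using Suc.prems assms(3) by (simp add: Cons_nth_drop_Suc)
    moreover have "q ! k \<in> set (nxt (drop (Suc k) q))"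
      using Suc.prems assms(2) by simp
    ultimately show ?case
      using Suc by (auto simp: list_ex_iff)
  qed
  then show ?thesis by simp
qed

section \<open>The gadget\<close>

text \<open>Adjacency lists, so that searches in \<open>H15\<close> can be evaluated.\<close>

fun nb15 :: "h15 \<Rightarrow> h15 list" where
  "nb15 Z = [A w7, B w7]"
| "nb15 (A v7) = [A a7, A c7, B v7]"
| "nb15 (B v7) = [B a7, B c7, A v7]"
| "nb15 (A w7) = [A b7, A d7, Z]"
| "nb15 (B w7) = [B b7, B d7, Z]"
| "nb15 (A a7) = [A v7, A b7, A c7]"
| "nb15 (B a7) = [B v7, B b7, B c7]"
| "nb15 (A b7) = [A a7, A w7, A d7]"
| "nb15 (B b7) = [B a7, B w7, B d7]"
| "nb15 (A c7) = [A v7, A a7, A u7]"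
| "nb15 (B c7) = [B v7, B a7, B u7]"
| "nb15 (A d7) = [A w7, A u7, A b7]"
| "nb15 (B d7) = [B w7, B u7, B b7]"
| "nb15 (A u7) = [A c7, A d7]"
| "nb15 (B u7) = [B c7, B d7]"

lemma H15_edges: "{p, q} \<in> edges H15 \<longleftrightarrow> q \<in> set (nb15 p)"
proof -
  have E: "edges H15 = {{A v7, A a7}, {A a7, A b7}, {A b7, A w7}, {A c7, A v7}, {A w7, A d7},
      {A a7, A c7}, {A c7, A u7}, {A u7, A d7}, {A d7, A b7},
      {B v7, B a7}, {B a7, B b7}, {B b7, B w7}, {B c7, B v7}, {B w7, B d7},
      {B a7, B c7}, {B c7, B u7}, {B u7, B d7}, {B d7, B b7},
      {A v7, B v7}, {A w7, Z}, {Z, B w7}}"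
    by (simp add: H15_def H7_def insert_commute)
  show ?thesis
    unfolding E by (cases p rule: nb15.cases; simp add: doubleton_eq_iff; blast)
qed

text \<open>A cycle of length 4 or 8 is a path that extends its start \<open>s\<close> by 3 or 7 new
  vertices and ends next to \<open>s\<close>.\<close>

lemma H15_search:
  "n = 3 \<or> n = 7 \<Longrightarrow> \<not> search (\<lambda>p. filter (\<lambda>w. w \<notin> set p) (nb15 (hd p))) (\<lambda>p. s \<in> set (nb15 (hd p))) n [s]"
proof -
  have "list_all (\<lambda>s. list_all (\<lambda>n. \<not> search (\<lambda>p. filter (\<lambda>w. w \<notin> set p) (nb15 (hd p))) (\<lambda>p. s \<in> set (nb15 (hd p))) n [s]) [3,7]) 
     [Z, A v7, A w7, A a7, A b7, A c7, A d7, A u7, B v7, B w7, B a7, B b7, B c7, B d7, B u7]"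
    by code_simp
  then show "n = 3 \<or> n = 7 \<Longrightarrow> \<not> search (\<lambda>p. filter (\<lambda>w. w \<notin> set p) (nb15 (hd p))) (\<lambda>p. s \<in> set (nb15 (hd p))) n [s]"
    by (cases s rule: nb15.cases; auto)
qed

lemma verts_H15: "verts H15 = UNIV"
proof -
  have "p \<in> verts H15" for p
    by (cases p rule: nb15.cases) (auto simp: H15_def H7_def)
  then show ?thesis by auto
qed

lemma card_verts_H15: "card (verts H15) = 15"
proof -
  have "verts H15 = set [Z, A v7, A w7, A a7, A b7, A c7, A d7, A u7, B v7, B w7, B a7, B b7, B c7, B d7, B u7]"
    by (auto simp: H15_def H7_def)
  then show ?thesis by (simp add: card_insert_if)
qed

lemma nb15_irrefl: "p \<notin> set (nb15 p)"
  by (cases p rule: nb15.cases) auto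

section \<open>Attachments and the distances between them\<close>

abbreviation attachments :: "h15 set" where
  "attachments \<equiv> {att_u, att_v, att_w}"

lemma card_nb15: "card (set (nb15 p)) = (if p \<in> attachments then 2 else 3)"
  by (cases p rule: nb15.cases) (auto simp: att_u_def att_v_def att_w_def)

text \<open>Table of the distances in \<open>H15\<close> from \<open>att_v\<close>;
  \<open>dist_u\<close> is the table for \<open>att_u\<close>. Two tables suffice, since any two
  distinct attachments include \<open>att_u\<close> or \<open>att_v\<close>.\<close>

definition dist_v :: "h15 \<Rightarrow> nat" where
  "dist_v q = (case q of Z \<Rightarrow> 3
     | B h \<Rightarrow> (case h of u7 \<Rightarrow> 0 | c7 \<Rightarrow> 1 | d7 \<Rightarrow> 1 | v7 \<Rightarrow> 2 | a7 \<Rightarrow> 2 | b7 \<Rightarrow> 2 | w7 \<Rightarrow> 2)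
     | A h \<Rightarrow> (case h of v7 \<Rightarrow> 3 | a7 \<Rightarrow> 4 | c7 \<Rightarrow> 4 | w7 \<Rightarrow> 4 | b7 \<Rightarrow> 5 | d7 \<Rightarrow> 5 | u7 \<Rightarrow> 5))"

definition dist_u :: "h15 \<Rightarrow> nat" where
  "dist_u q = (let d = (\<lambda>h. case h of w7 \<Rightarrow> 1 | b7 \<Rightarrow> 2 | d7 \<Rightarrow> 2 | a7 \<Rightarrow> 3 | u7 \<Rightarrow> 3 | c7 \<Rightarrow> 4 | v7 \<Rightarrow> 4)
     in case q of Z \<Rightarrow> 0 | A h \<Rightarrow> d h | B h \<Rightarrow> d h)"

lemma dist_step:
  assumes "q \<in> set (nb15 p)"
  shows "dist_v q \<le> Suc (dist_v p)" "dist_u q \<le> Suc (dist_u p)"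
  using assms by (cases p rule: nb15.cases; auto simp: dist_v_def dist_u_def)+

text \<open>Each step raises either distance by at most 1. The inequalities are strict because
  \<open>length ps\<close> counts vertices, one more than steps.\<close>

lemma dist_ualk:
  assumes "walk H15 ps" "ps \<noteq> []"
  shows "dist_v (last ps) < length ps + dist_v (hd ps) \<and> dist_u (last ps) < length ps + dist_u (hd ps)"
  using assms
proof (induction ps rule: induct_list012)
  case (3 p q ps)
  then have "q \<in> set (nb15 p)" and "dist_v (last (q # ps)) < length (q # ps) + dist_v q"
    "dist_u (last (q # ps)) < length (q # ps) + dist_u q"
    by (auto simp: H15_edges)
  with dist_step[of q p] show ?case by simp
qed auto

text \<open>By the tables, \<open>att_u\<close> is at distance 3 from both other attachments, and
  these are at distance 5 from each other. So a walk has at least 4 vertices, and at least 6 if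
  neither end is \<open>att_u\<close>.\<close>

lemma walk_between_attachments:
  assumes "walk H15 ps" "ps \<noteq> []" "hd ps \<in> attachments" "last ps \<in> attachments" "hd ps \<noteq> last ps"
  shows "4 \<le> length ps" and "length ps = 4 \<Longrightarrow> hd ps = att_u \<or> last ps = att_u"
proof -
  \<comment> \<open>The bounds bite when the walk starts at \<open>att_u\<close> or
    \<open>att_v\<close>; reversal covers the walks that end there.\<close>
  have "walk H15 (rev ps)"
    using assms(1) by (simp add: insert_commute)
  then have "dist_v (hd ps) < length ps + dist_v (last ps)" "dist_u (hd ps) < length ps + dist_u (last ps)"
    using dist_ualk[of "rev ps"] assms(2) by (simp_all add: hd_rev last_rev)
  then show "4 \<le> length ps" "length ps = 4 \<Longrightarrow> hd ps = att_u \<or> last ps = att_u"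
    using assms(3-5) dist_ualk[OF assms(1,2)]
    by (auto simp: dist_v_def dist_u_def att_u_def att_v_def att_w_def)
qed

lemma H15_no_cycle:
  assumes "n = 4 \<or> n = 8" "walk H15 d" "distinct d" "length d = n" "{last d, hd d} \<in> edges H15"
  shows False
proof -
  \<comment> \<open>The search lists the newest vertex first, so the path that starts at
    \<open>hd d\<close> appears reversed.\<close>
  define q where "q = rev d"
  define nxt where "nxt = (\<lambda>p. filter (\<lambda>w. w \<notin> set p) (nb15 (hd p)))"
  have ne: "d \<noteq> []" and lq: "length q = n" and dq: "distinct q" using assms by (auto simp: q_def)
  have wq: "walk H15 q" using assms(2) by (simp add: q_def insert_commute)
  have "q ! i \<in> set (nxt (drop (Suc i) q))" if "i < n - 1" for i
  proof -
    have i: "Suc i < length q" using that lq by simp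
    have "{q ! i, q ! Suc i} \<in> edges H15" using wq i by (simp add: successively_conv_nth)
    then have "q ! i \<in> set (nb15 (hd (drop (Suc i) q)))"
      using i by (simp add: hd_drop_conv_nth H15_edges[symmetric] insert_commute)
    moreover have "q ! i \<notin> set (drop (Suc i) q)"
      using dq i by (metis Cons_nth_drop_Suc Suc_lessD distinct.simps(2) distinct_drop)
    ultimately show ?thesis by (simp add: nxt_def)
  qed
  moreover have "hd d \<in> set (nb15 (hd q))"
    using assms(5) ne by (simp add: q_def hd_rev H15_edges)
  ultimately have "search nxt (\<lambda>p. hd d \<in> set (nb15 (hd p))) (n - 1) (drop (n - 1) q)"
    using lq by (intro search_complete) auto
  moreover have "drop (n - 1) q = [hd d]"
  proof -
    have "n - 1 < length q" "Suc (n - 1) = length q" "q ! (n - 1) = hd d"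
      using lq assms(1) ne by (auto simp: q_def rev_nth hd_conv_nth)
    then show ?thesis by (metis Cons_nth_drop_Suc drop_all order_refl)
  qed
  ultimately show False
    using H15_search[of "n - 1" "hd d"] assms(1) by (auto simp: nxt_def)
qed

section \<open>Cycles in the replacement\<close>

locale replacement =
  fixes G :: "'a graph" and \<beta> :: "'a \<Rightarrow> 'a set \<Rightarrow> h15"
  assumes cubic: "cubic G" and assignment: "assignment G \<beta>"
begin

lemma simple: "simple_graph G"
  using cubic by (simp add: cubic_def)

definition R :: "('a \<times> h15) graph" where
  "R = H15_replacement G \<beta>"

lemma bij: "x \<in> verts G \<Longrightarrow> bij_betw (\<beta> x) (incident G x) attachments"
  using assignment by (simp add: assignment_def)

lemma incidentI: "{x, y} \<in> edges G \<Longrightarrow> {x, y} \<in> incident G x"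
  by (simp add: incident_def)

lemma \<beta>_attachment: "{x, y} \<in> edges G \<Longrightarrow> \<beta> x {x, y} \<in> attachments"
  using bij[of x] edge_in_verts[OF simple] incidentI by (metis bij_betwE)

lemma \<beta>_inj:
  assumes "{x, y} \<in> edges G" "{x, z} \<in> edges G" "\<beta> x {x, y} = \<beta> x {x, z}"
  shows "y = z"
proof -
  have "{x, y} = {x, z}"
    using bij[of x] assms edge_in_verts[OF simple] incidentI
    by (metis bij_betw_imp_inj_on inj_onD)
  then show ?thesis by (auto simp: doubleton_eq_iff)
qed

section \<open>Order and degrees of the replacement\<close>

lemma verts_R: "verts R = verts G \<times> UNIV"
  by (simp add: R_def H15_replacement_def verts_H15)

lemma edges_R:
  "{(x, p), (y, q)} \<in> edges R \<longleftrightarrow>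
     x = y \<and> x \<in> verts G \<and> q \<in> set (nb15 p) \<or>
     {x, y} \<in> edges G \<and> p = \<beta> x {x, y} \<and> q = \<beta> y {x, y}"
  by (auto simp: R_def H15_replacement_def H15_edges[symmetric] doubleton_eq_iff insert_commute)

lemma edges_R_cases:
  assumes "e \<in> edges R"
  obtains x p y q where "e = {(x, p), (y, q)}"
  using assms by (auto simp: R_def H15_replacement_def)

lemma simple_R: "simple_graph R"
proof -
  have "finite (verts R)"
    using simple card_ge_0_finite[of "verts H15"]
    by (simp add: R_def H15_replacement_def simple_graph_def card_verts_H15)
  moreover have "e \<subseteq> verts R \<and> card e = 2" if e: "e \<in> edges R" for e
  proof -
    obtain x p y q where eq: "e = {(x, p), (y, q)}"
      using e by (rule edges_R_cases)
    then show ?thesis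
      using e edge_in_verts[OF simple, of x y] nb15_irrefl[of p]
      by (auto simp: edges_R verts_R card_insert_if)
  qed
  ultimately show ?thesis by (simp add: simple_graph_def)
qed

lemma card_verts_R: "card (verts R) = 15 * card (verts G)"
  by (simp add: R_def H15_replacement_def card_cartesian_product card_verts_H15)

lemma nbrs_R:
  assumes "x \<in> verts G"
  shows "nbrs R (x, p) = Pair x ` set (nb15 p)
    \<union> (\<lambda>y. (y, \<beta> y {x, y})) ` {y. {x, y} \<in> edges G \<and> \<beta> x {x, y} = p}"
  using assms by (auto simp: nbrs_def edges_R)

text \<open>Bijectivity of \<open>\<beta> x\<close> gives each attachment exactly one edge at
  \<open>x\<close>, and no edge to other vertices of the copy.\<close>

lemma card_outer:
  assumes "x \<in> verts G"
  shows "card {y. {x, y} \<in> edges G \<and> \<beta> x {x, y} = p} = (if p \<in> attachments then 1 else 0)"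
proof (cases "p \<in> attachments")
  case True
  then obtain e where e: "e \<in> incident G x" "\<beta> x e = p"
    using bij[OF assms] by (metis bij_betw_imp_surj_on imageE)
  then obtain y where "e = {x, y}" "{x, y} \<in> edges G"
    using incident_eq_image_nbrs[OF simple, of x] by (auto simp: nbrs_def)
  then have "{y. {x, y} \<in> edges G \<and> \<beta> x {x, y} = p} = {y}"
    using e \<beta>_inj by blast
  then show ?thesis using True by simp
next
  case False
  then have "{y. {x, y} \<in> edges G \<and> \<beta> x {x, y} = p} = {}"
    using \<beta>_attachment by blast
  then show ?thesis using False by (simp only: card.empty if_False)
qed

text \<open>Neighbours inside and outside the copy add up to 2 + 1 at an attachment and to 3 + 0
  elsewhere.\<close>

lemma cubic_R: "cubic R"
proof -
  have "degree R v = 3" if v: "v \<in> verts R" for v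
  proof -
    obtain x p where xp: "v = (x, p)" "x \<in> verts G"
      using v by (auto simp: verts_R)
    let ?Y = "{y. {x, y} \<in> edges G \<and> \<beta> x {x, y} = p}"
    have "?Y \<subseteq> verts G" using edge_in_verts[OF simple] by blast
    then have fin: "finite ?Y"
      using simple finite_subset by (auto simp: simple_graph_def)
    have "Pair x ` set (nb15 p) \<inter> (\<lambda>y. (y, \<beta> y {x, y})) ` ?Y = {}"
      using edge_in_verts(3)[OF simple] by blast
    moreover have "card ((\<lambda>y. (y, \<beta> y {x, y})) ` ?Y) = card ?Y"
      by (intro card_image inj_onI) auto
    moreover have "card (Pair x ` set (nb15 p)) = card (set (nb15 p))"
      by (intro card_image inj_onI) auto
    ultimately show ?thesis
      using card_outer[OF xp(2), of p] card_nb15[of p] fin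
      by (simp add: xp degree_eq_card_nbrs[OF simple_R] nbrs_R card_Un_disjoint)
  qed
  then show ?thesis by (simp add: cubic_def simple_R)
qed

end

section \<open>Projection of cycles to the base graph\<close>

locale oriented_replacement = replacement +
  fixes \<omega> :: "'a \<Rightarrow> 'a set"
  assumes orientation: "orientation G \<omega>" and realises: "realises G \<beta> \<omega>"
begin

text \<open>The passage from \<open>y\<close> through \<open>x\<close> to \<open>z\<close> uses the attachment \<open>u\<close> of the copy at \<open>x\<close>.\<close>

abbreviation turn :: "'a \<Rightarrow> 'a \<Rightarrow> 'a \<Rightarrow> bool" where
  "turn y x z \<equiv> \<omega> x = {y, x} \<or> \<omega> x = {x, z}"

text \<open>\<open>ps\<close> is the stretch of a cycle inside the copy at \<open>x\<close>, entered
  from \<open>y\<close> and left towards \<open>z\<close>. If \<open>y = z\<close>, both ends are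
  the same attachment, so distinctness makes \<open>ps\<close> a single vertex, which
  \<open>nb\<close> excludes. Otherwise the distance bounds apply.\<close>

lemma block:
  assumes ps: "walk H15 ps" "distinct ps" "ps \<noteq> []"
    and e: "{y, x} \<in> edges G" "{x, z} \<in> edges G"
    and ends: "hd ps = \<beta> x {y, x}" "last ps = \<beta> x {x, z}"
    and nb: "length ps = 1 \<Longrightarrow> y \<noteq> z"
  shows "y \<noteq> z" "4 \<le> length ps" "length ps = 4 \<Longrightarrow> turn y x z"
proof -
  have x: "x \<in> verts G" using edge_in_verts[OF simple] e by blast
  have e': "{x, y} \<in> edges G" using e by (simp add: insert_commute)
  have in_att: "hd ps \<in> attachments" "last ps \<in> attachments"
    using \<beta>_attachment[OF e'] \<beta>_attachment[OF e(2)] ends by (simp_all add: insert_commute)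
  show "y \<noteq> z"
  proof
    assume "y = z"
    then have "hd ps = last ps" using ends by (simp add: insert_commute)
    then have "length ps = 1"
      using ps(2,3) by (cases ps) (auto split: if_splits)
    then show False using nb \<open>y = z\<close> by simp
  qed
  then have ne: "hd ps \<noteq> last ps"
    using \<beta>_inj[OF e' e(2)] ends by (auto simp: insert_commute)
  show "4 \<le> length ps"
    using walk_between_attachments(1)[OF ps(1,3) in_att ne] .
  assume "length ps = 4"
  then have "hd ps = att_u \<or> last ps = att_u"
    using walk_between_attachments(2)[OF ps(1,3) in_att ne] by simp
  \<comment> \<open>\<open>att_u\<close> is the value of \<open>\<beta> x\<close> at
    \<open>\<omega> x\<close>; injectivity of \<open>\<beta> x\<close> will turn equal attachments
    into equal edges.\<close>
  then have "\<beta> x {y, x} = \<beta> x (\<omega> x) \<or> \<beta> x {x, z} = \<beta> x (\<omega> x)"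
    using realises x ends by (simp add: realises_def)
  moreover have "\<omega> x \<in> incident G x" "{y, x} \<in> incident G x" "{x, z} \<in> incident G x"
    using orientation x e by (auto simp: orientation_def incident_def)
  ultimately show "turn y x z"
    using bij[OF x] by (metis bij_betw_imp_inj_on inj_onD)
qed

text \<open>An edge between copies changes the first component, as \<open>G\<close> has no loops; so
  only gadget edges remain.\<close>

lemma fst_const_walk:
  assumes "walk R c" "\<forall>v\<in>set c. fst v = x"
  shows "walk H15 (map snd c)"
proof -
  have "{snd a, snd b} \<in> edges H15" if "a \<in> set c" "b \<in> set c" "{a, b} \<in> edges R" for a b
  proof (cases a; cases b)
    fix s p t q assume [simp]: "a = (s, p)" "b = (t, q)"
    have "fst a = fst b" using that(1,2) assms(2) by metis
    then have "s = t" by simp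
    then have "q \<in> set (nb15 p)"
      using that edges_R[of s p t q] edge_in_verts(3)[OF simple, of s t] by auto
    then show ?thesis by (simp add: H15_edges)
  qed
  then show ?thesis
    using assms(1) by (auto simp: successively_map intro: successively_mono)
qed

text \<open>\<open>c\<close> is a piece of a cycle, entered from the copy at \<open>y\<close> and
  left to the copy at \<open>z\<close>; the last three premises forbid turning back along these two
  edges. Its stretches inside single copies give the entries of \<open>xs\<close>. By
  \<open>block\<close> each has at least 4 vertices, and equality in the sum forces exactly 4, hence
  a turn, in each.\<close>

lemma walk_decomposition:
  assumes "walk R c" "distinct c" "c \<noteq> []"
    and "hd c = (x, \<beta> x {y, x})" "{y, x} \<in> edges G"
    and "last c = (t, \<beta> t {t, z})" "{t, z} \<in> edges G"
    and "length c = 1 \<Longrightarrow> y \<noteq> z"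
    and "1 < length c \<Longrightarrow> c ! 1 \<noteq> (y, \<beta> y {y, x})"
    and "1 < length c \<Longrightarrow> c ! (length c - 2) \<noteq> (z, \<beta> z {t, z})"
  shows "\<exists>xs. xs \<noteq> [] \<and> hd xs = x \<and> last xs = t \<and> walk G (y # xs @ [z]) \<and> reduced (y # xs @ [z]) \<and>
    4 * length xs \<le> length c \<and> (4 * length xs = length c \<longrightarrow> triples turn (y # xs @ [z]))"
  using assms
proof (induction "length c" arbitrary: c x y rule: less_induct)
  case less
  let ?in = "\<lambda>v. fst v = x"
  define b where "b = takeWhile ?in c"
  define r where "r = dropWhile ?in c"
  have c: "c = b @ r" by (simp add: b_def r_def)
  have bx: "\<forall>v\<in>set b. fst v = x" by (auto simp: b_def dest: set_takeWhileD)
  have b_ne: "b \<noteq> []" and hd_b: "hd b = hd c"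
    using less.prems(3,4) by (cases c; simp add: b_def)+
  have last_b: "fst (last b) = x" using bx b_ne by simp
  have wb: "walk R b" and wr: "walk R r" and br: "r \<noteq> [] \<Longrightarrow> {last b, hd r} \<in> edges R"
    using less.prems(1) b_ne by (auto simp: c successively_append_iff)
  have db: "distinct b" and dr: "distinct r" using less.prems(2) by (auto simp: c)
  have H: "walk H15 (map snd b)" "distinct (map snd b)" "map snd b \<noteq> []" "hd (map snd b) = \<beta> x {y, x}"
    using fst_const_walk[OF wb bx] db bx b_ne hd_b less.prems(4)
    by (auto simp: distinct_map inj_on_def prod_eq_iff hd_map)
  show ?case
  proof (cases "r = []")
    case True
    then have cb: "c = b" using c by simp
    have t: "t = x" using last_b less.prems(6) cb by simp
    have "last (map snd b) = \<beta> x {x, z}"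
      using less.prems(6) b_ne by (simp add: cb t last_map)
    note B = block[OF H(1-3) less.prems(5) _ H(4) this]
    have "y \<noteq> z" "4 \<le> length b" "length b = 4 \<Longrightarrow> turn y x z"
      using B less.prems(7,8) by (auto simp: t cb)
    then show ?thesis
      using less.prems(5,7) t by (intro exI[of _ "[x]"]) (auto simp: cb)
  next
    case False
    obtain x' p' where hr: "hd r = (x', p')" by fastforce
    have "x' \<noteq> x"
      using hd_dropWhile[of ?in c] False hr by (auto simp: r_def)
    obtain q where lb: "last b = (x, q)" using last_b by (cases "last b") auto
    have e: "{x, x'} \<in> edges G" "q = \<beta> x {x, x'}" "p' = \<beta> x' {x, x'}"
      using br[OF False] \<open>x' \<noteq> x\<close> by (auto simp: lb hr edges_R)
    have lq: "last (map snd b) = \<beta> x {x, x'}"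
      using lb b_ne e by (simp add: last_map)
    \<comment> \<open>A one-vertex stretch with \<open>y = x'\<close> would return along the
      entering edge, against the premise on \<open>c ! 1\<close>.\<close>
    have "y \<noteq> x'" if "length b = 1"
    proof
      assume "y = x'"
      then have "hd r = (y, \<beta> y {y, x})"
        using hr e by (simp add: insert_commute)
      moreover have "c ! 1 = hd r" "1 < length c"
        using that False by (auto simp: c nth_append hd_conv_nth)
      ultimately show False using less.prems(9) by simp
    qed
    then have B: "y \<noteq> x'" "4 \<le> length b" "length b = 4 \<Longrightarrow> turn y x x'"
      using block[OF H(1-3) less.prems(5) e(1) H(4) lq] by auto
    have last_r: "last r = (t, \<beta> t {t, z})" using less.prems(6) False c by simp
    \<comment> \<open>The penultimate vertex of \<open>c\<close> lies in \<open>r\<close>, unless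
      \<open>r\<close> is a single vertex and it is \<open>last b\<close>. Accordingly the premise
      on the exit edge yields \<open>r3\<close> or \<open>r1\<close>.\<close>
    have lr: "c ! (length c - 2) = (if length r = 1 then last b else r ! (length r - 2))"
    proof (cases "length r = 1")
      case True
      then have "length c - 2 = length b - 1" "0 < length b" using b_ne by (auto simp: c)
      then show ?thesis
        using b_ne True by (simp add: c nth_append last_conv_nth)
    next
      case ne: False
      have "1 < length r" using False ne by (cases r) auto
      moreover have "length c - 2 = length b + (length r - 2)"
        using \<open>1 < length r\<close> by (simp add: c)
      moreover have "c ! (length b + k) = r ! k" for k by (simp add: c)
      ultimately show ?thesis using ne by (simp only: if_False)
    qed
    have c2: "1 < length c" using B(2) by (simp add: c)
    have r1: "x \<noteq> z" if "length r = 1"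
    proof
      assume "x = z"
      have "t = x'" using that last_r hr by (cases r) auto
      then show False
        using less.prems(10)[OF c2] lr that lb e \<open>x = z\<close> by (simp add: insert_commute)
    qed
    \<comment> \<open>The predecessor of \<open>hd r\<close> is \<open>last b\<close>, which
      distinctness keeps out of \<open>r\<close>.\<close>
    have r2: "r ! 1 \<noteq> (x, \<beta> x {x, x'})" if "1 < length r"
    proof -
      have "r ! 1 \<in> set r" "last b \<in> set b" using that b_ne by auto
      then have "r ! 1 \<noteq> last b" using less.prems(2) by (auto simp: c)
      then show ?thesis using lb e by simp
    qed
    have r3: "r ! (length r - 2) \<noteq> (z, \<beta> z {t, z})" if "1 < length r"
      using less.prems(10)[OF c2] lr that by simp
    have hd_r: "hd r = (x', \<beta> x' {x, x'})" using hr e by simp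
    have "length r < length c" using b_ne by (simp add: c)
    from less.hyps[OF this wr dr False hd_r e(1) last_r less.prems(7) r1 r2 r3]
    obtain xs where xs: "xs \<noteq> []" "hd xs = x'" "last xs = t" "walk G (x # xs @ [z])"
        "reduced (x # xs @ [z])" "4 * length xs \<le> length r"
        "4 * length xs = length r \<longrightarrow> triples turn (x # xs @ [z])"
      by blast
    obtain xs' where xs': "xs = x' # xs'" using xs(1,2) by (cases xs) auto
    \<comment> \<open>The bounds for \<open>b\<close> and \<open>r\<close> add up, with equality
      only if both are tight.\<close>
    have "length c = length b + length r" by (simp add: c)
    then show ?thesis
      using xs B less.prems(5) by (intro exI[of _ "x # xs"]) (auto simp: xs')
  qed
qed

end

context oriented_replacement
begin

text \<open>If the first component is constant, the cycle lies in one copy. Otherwise it is cut open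
  at an edge between two copies, which leaves a walk for \<open>walk_decomposition\<close>.\<close>

lemma cycle_in_gadget_or_lift:
  assumes c: "is_cycle R c"
  shows "(\<exists>d. walk H15 d \<and> distinct d \<and> length d = length c \<and> {last d, hd d} \<in> edges H15) \<or>
    (\<exists>xs. xs \<noteq> [] \<and> walk G (last xs # xs @ [hd xs]) \<and> reduced (last xs # xs @ [hd xs]) \<and>
      4 * length xs \<le> length c \<and>
      (4 * length xs = length c \<longrightarrow> triples turn (last xs # xs @ [hd xs])))"
proof -
  define n where "n = length c"
  have n: "3 \<le> n" and dc: "distinct c" and E: "\<And>i. i < n \<Longrightarrow> {c ! i, c ! (Suc i mod n)} \<in> edges R"
    using c by (auto simp: is_cycle_def n_def)
  have c_ne: "c \<noteq> []" using n n_def by auto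
  show ?thesis
  proof (cases "\<forall>i<n. fst (c ! i) = fst (c ! (Suc i mod n))")
    case True
    have const: "fst (c ! i) = fst (c ! 0)" if "i < n" for i
      using that
    proof (induction i)
      case (Suc i)
      then show ?case using True by (metis Suc_lessD mod_less)
    qed auto
    have w: "walk R c"
      unfolding successively_conv_nth
    proof (intro allI impI)
      fix i assume "Suc i < length c"
      then show "{c ! i, c ! Suc i} \<in> edges R" using E[of i] by (simp add: n_def)
    qed
    obtain x where fst_c: "\<forall>v\<in>set c. fst v = x"
      using const by (metis in_set_conv_nth n_def)
    have "Suc (n - 1) mod n = 0" using n by simp
    then have "{last c, hd c} \<in> edges R"
      using E[of "n - 1"] n c_ne by (simp add: last_conv_nth hd_conv_nth n_def)
    then have "walk R [last c, hd c]" by simp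
    moreover have "\<forall>v\<in>set [last c, hd c]. fst v = x"
      using fst_c c_ne by simp
    ultimately have "walk H15 (map snd [last c, hd c])" by (rule fst_const_walk)
    then have "{last (map snd c), hd (map snd c)} \<in> edges H15"
      using c_ne by (simp add: last_map hd_map)
    moreover have "distinct (map snd c)"
      unfolding distinct_map
    proof (intro conjI dc inj_onI)
      fix v w assume "v \<in> set c" "w \<in> set c" "snd v = snd w"
      then show "v = w" using fst_c by (metis prod_eqI)
    qed
    ultimately show ?thesis
      using fst_const_walk[OF w fst_c] length_map[of snd c] by blast
  next
    case False
    then obtain i where i: "i < n" "fst (c ! i) \<noteq> fst (c ! (Suc i mod n))" by blast
    \<comment> \<open>The rotation puts \<open>c ! i\<close> last and its successor first, so the
      closing edge of \<open>c'\<close> is the one between copies.\<close>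
    define c' where "c' = rotate (Suc i) c"
    have len: "length c' = n" and dc': "distinct c'" using dc by (simp_all add: c'_def n_def)
    have c'_ne: "c' \<noteq> []" using len n by auto
    have nth: "c' ! k = c ! ((Suc i + k) mod n)" if "k < n" for k
      using that by (simp add: c'_def n_def nth_rotate del: rotate_Suc)
    have w: "walk R c'"
      unfolding successively_conv_nth
    proof (intro allI impI)
      fix k assume k: "Suc k < length c'"
      have "Suc ((Suc i + k) mod n) mod n = (Suc i + Suc k) mod n"
        by (simp add: mod_Suc_eq)
      then show "{c' ! k, c' ! Suc k} \<in> edges R"
        using E[of "(Suc i + k) mod n"] k len n by (simp add: nth)
    qed
    have hd_c': "hd c' = c ! (Suc i mod n)"
      using nth[of 0] n c'_ne by (simp add: hd_conv_nth)
    have "(Suc i + (n - 1)) mod n = i" using i n by simp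
    then have last_c': "last c' = c ! i"
      using nth[of "n - 1"] n c'_ne len by (simp add: last_conv_nth)
    obtain t q where tq: "last c' = (t, q)" by fastforce
    obtain x p where xp: "hd c' = (x, p)" by fastforce
    have "t \<noteq> x" using i(2) tq xp hd_c' last_c' by simp
    moreover have "{(t, q), (x, p)} \<in> edges R"
      using E[OF i(1)] tq xp hd_c' last_c' by simp
    ultimately have e: "{t, x} \<in> edges G" "q = \<beta> t {t, x}" "p = \<beta> x {t, x}"
      by (auto simp: edges_R)
    \<comment> \<open>The closing edge serves as both entry and exit, so \<open>c'\<close> is
      preceded by its own last vertex and followed by its first; \<open>3 \<le> n\<close> separates
      these from the second and the penultimate vertex.\<close>
    have "c' ! 1 \<noteq> last c'" "c' ! (n - 2) \<noteq> hd c'"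
      using dc' len n c'_ne by (auto simp: last_conv_nth hd_conv_nth nth_eq_iff_index_eq)
    then obtain xs where "xs \<noteq> []" "hd xs = x" "last xs = t" "walk G (t # xs @ [x])"
      "reduced (t # xs @ [x])" "4 * length xs \<le> length c'"
      "4 * length xs = length c' \<longrightarrow> triples turn (t # xs @ [x])"
      using walk_decomposition[OF w dc' c'_ne, of x t t x] e tq xp len n by auto
    then show ?thesis using len n_def by auto
  qed
qed

end

section \<open>The Tutte--Coxeter graph\<close>

text \<open>The offset of the chord at \<open>x\<close> depends only on \<open>x mod 6\<close>.\<close>

definition tc_nb :: "nat \<Rightarrow> nat list" where
  "tc_nb x = [(x + 1) mod 30, (x + 29) mod 30, (x + [17, 21, 7, 23, 9, 13] ! (x mod 6)) mod 30]"

text \<open>\<open>take 2 p\<close> holds the current vertex and the one before it, so the search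
  runs through the walks without immediate return; none closes up after 1 to 7 steps.\<close>

lemma TC_search:
  "list_all (\<lambda>s. list_all (\<lambda>n. \<not> search (\<lambda>p. filter (\<lambda>w. w \<notin> set (take 2 p)) (tc_nb (hd p))) (\<lambda>p. hd p = s) n [s]) [1..<8]) [0..<30]"
  by code_simp

text \<open>An explicit edge list, which can be compared with \<open>tc_nb\<close> by
  evaluation.\<close>

definition tc_edges :: "(nat \<times> nat) list" where
  "tc_edges = map (\<lambda>i. (i, (i + 1) mod 30)) [0..<30]
     @ map (\<lambda>t. ((29 + 6 * t) mod 30, (12 + 6 * t) mod 30)) [0..<5]
     @ map (\<lambda>t. ((28 + 6 * t) mod 30, (7 + 6 * t) mod 30)) [0..<5]
     @ map (\<lambda>t. ((26 + 6 * t) mod 30, (3 + 6 * t) mod 30)) [0..<5]"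

lemma edges_TC: "edges TC = (\<lambda>(a, b). {a, b}) ` set tc_edges"
proof -
  have *: "{h i | i. i < n} = h ` {0..<n}" for h :: "nat \<Rightarrow> nat set" and n
    by auto
  show ?thesis
    by (simp only: TC_def tc_edges_def graph.simps * set_append set_map set_upt image_Un image_image
        prod.case Un_assoc)
qed

lemma tc_edges_nb:
  "list_all (\<lambda>(x, y). x < 30 \<and> y < 30 \<and> y \<in> set (tc_nb x) \<and> x \<in> set (tc_nb y)) tc_edges"
  "list_all (\<lambda>x. list_all (\<lambda>y. (x, y) \<in> set tc_edges \<or> (y, x) \<in> set tc_edges) (tc_nb x)) [0..<30]"
  "list_all (\<lambda>x. distinct (x # tc_nb x)) [0..<30]"
  by code_simp+

lemma TC_edge: "{x, y} \<in> edges TC \<longleftrightarrow> x < 30 \<and> y \<in> set (tc_nb x)"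
proof -
  have "{x, y} \<in> edges TC \<longleftrightarrow> (x, y) \<in> set tc_edges \<or> (y, x) \<in> set tc_edges"
    by (auto simp: edges_TC doubleton_eq_iff image_iff split: prod.splits)
  then show ?thesis
    using tc_edges_nb(1,2) by (auto simp: list_all_iff)
qed

lemma tc_nb_simps: "x < 30 \<Longrightarrow> distinct (tc_nb x)" "x < 30 \<Longrightarrow> x \<notin> set (tc_nb x)"
  using tc_edges_nb(3) by (auto simp: list_all_iff)

lemma verts_TC: "verts TC = {..<30}"
  by (auto simp: TC_def)

lemma cubic_TC: "cubic TC"
proof -
  have "e \<subseteq> verts TC \<and> card e = 2" if e_in: "e \<in> edges TC" for e
  proof -
    obtain x y where e: "e = {x, y}" using e_in by (auto simp: edges_TC)
    then have "{y, x} \<in> edges TC" using e_in by (simp add: insert_commute)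
    then show ?thesis
      using e_in tc_nb_simps(2)[of x] by (auto simp: e TC_edge verts_TC card_insert_if)
  qed
  then have s: "simple_graph TC"
    by (simp add: simple_graph_def verts_TC)
  have "degree TC x = 3" if "x \<in> verts TC" for x
  proof -
    have "nbrs TC x = set (tc_nb x)" using that by (simp add: nbrs_def TC_edge verts_TC)
    then show ?thesis
      using that tc_nb_simps(1)[of x] s
      by (simp add: degree_eq_card_nbrs distinct_card verts_TC del: set_map) (simp add: tc_nb_def)
  qed
  with s show ?thesis by (simp add: cubic_def)
qed

text \<open>A shorter walk, read from its end, would be found by \<open>TC_search\<close>. The end
  vertex is counted twice, so \<open>8 < length q\<close> means at least 8 steps.\<close>

lemma TC_girth:
  assumes "walk TC q" "reduced q" "1 < length q" "hd q = last q"
  shows "8 < length q"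
proof (rule ccontr)
  assume "\<not> 8 < length q"
  define n where "n = length q - 1"
  have n: "length q = Suc n" "n \<in> set [1..<8]" using assms(3) \<open>\<not> 8 < length q\<close> by (auto simp: n_def)
  have ne: "q \<noteq> []" using assms(3) by auto
  define nxt where "nxt = (\<lambda>p. filter (\<lambda>w. w \<notin> set (take 2 p)) (tc_nb (hd p)))"
  have E: "{q ! Suc i, q ! i} \<in> edges TC" if "Suc i < length q" for i
    using that assms(1) by (simp add: successively_conv_nth insert_commute)
  have "q ! i \<in> set (nxt (drop (Suc i) q))" if "i < n" for i
  proof -
    have i: "Suc i < length q" using that n by simp
    have "q ! i \<noteq> q ! Suc i"
      using E[OF i] tc_nb_simps(2) by (auto simp: TC_edge)
    moreover have "q ! i \<noteq> q ! Suc (Suc i)" if "Suc (Suc i) < length q"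
      using triples_nth[OF assms(2) that] .
    moreover have "\<exists>k<2. Suc i + k < length q \<and> q ! (Suc i + k) = q ! i"
      if "q ! i \<in> set (take 2 (drop (Suc i) q))"
      using that by (auto simp: in_set_conv_nth)
    ultimately have "q ! i \<notin> set (take 2 (drop (Suc i) q))"
      by (auto simp: less_2_cases_iff)
    then show ?thesis
      using E[OF i] i by (simp add: nxt_def hd_drop_conv_nth TC_edge)
  qed
  then have "search nxt (\<lambda>p. hd p = last q) n (drop n q)"
    using assms(4) n by (intro search_complete) auto
  moreover have "drop n q = [last q]"
    using n ne by (metis Cons_nth_drop_Suc drop_all last_conv_nth lessI n_def order_refl)
  moreover have "last q \<in> set [0..<30]"
    using E[of 0] assms(3,4) ne by (auto simp: TC_edge hd_conv_nth insert_commute)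
  from TC_search[unfolded list_all_iff, rule_format, OF this n(2)]
  have "\<not> search nxt (\<lambda>p. hd p = last q) n [last q]"
    unfolding nxt_def .
  ultimately show False by simp
qed

section \<open>Orientation along the Hamiltonian cycle and exclusion of short cycles\<close>

definition tc_orientation :: "nat \<Rightarrow> nat set" where
  "tc_orientation x = {x, (x + 1) mod 30}"

lemma orientation_TC: "orientation TC tc_orientation"
  by (auto simp: orientation_def incident_def tc_orientation_def TC_edge tc_nb_def verts_TC)

lemma successor_closed:
  assumes "S \<noteq> {}" "S \<subseteq> {..<n}" "\<And>x. x \<in> S \<Longrightarrow> (x + 1) mod n \<in> S"
  shows "S = {..<n::nat}"
proof -
  obtain x where x: "x \<in> S" using assms(1) by blast
  have k: "(x + k) mod n \<in> S" for k
  proof (induction k)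
    case 0
    then show ?case using x assms(2) by auto
  next
    case (Suc k)
    then show ?case using assms(3) by (metis Suc_eq_plus1 add_Suc_right mod_Suc_eq)
  qed
  have "y \<in> S" if "y < n" for y
  proof -
    have "x < n" using x assms(2) by auto
    \<comment> \<open>From \<open>x\<close>, \<open>n - x\<close> steps lead to 0 and
      \<open>y\<close> more to \<open>y\<close>.\<close>
    then have "(x + (n - x + y)) mod n = y" using that by simp
    then show ?thesis using k by metis
  qed
  then show ?thesis using assms(2) by auto
qed

lemma TC_replacement_no_cycle:
  assumes "realises TC \<beta> tc_orientation" "n \<in> {4, 8, 16, 32}"
  shows "\<not> has_cycle_of_length (H15_replacement TC \<beta>) n"
proof
  assume "has_cycle_of_length (H15_replacement TC \<beta>) n"
  interpret oriented_replacement TC \<beta> tc_orientation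
    using assms(1) cubic_TC orientation_TC by unfold_locales (auto simp: realises_def)
  obtain c where c: "is_cycle R c" "length c = n"
    using \<open>has_cycle_of_length _ n\<close> by (auto simp: has_cycle_of_length_def R_def)
  show False
    using cycle_in_gadget_or_lift[OF c(1)]
  proof (elim disjE exE conjE)
    fix d assume d: "walk H15 d" "distinct d" "length d = length c" "{last d, hd d} \<in> edges H15"
    \<comment> \<open>With 15 vertices, one copy has no room for cycles of length 16 or 32.\<close>
    have "length d \<le> card (verts H15)"
      using d(2) by (metis card_verts_H15 distinct_card card_mono card_ge_0_finite subset_UNIV verts_H15 zero_less_numeral)
    then have "n = 4 \<or> n = 8" using assms(2) c(2) d(3) by (auto simp: card_verts_H15)
    then show False using H15_no_cycle d c(2) by metis
  next
    fix xs assume xs: "xs \<noteq> []" "walk TC (last xs # xs @ [hd xs])" "reduced (last xs # xs @ [hd xs])"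
      "4 * length xs \<le> length c"
      and tight: "4 * length xs = length c \<longrightarrow> triples turn (last xs # xs @ [hd xs])"
    \<comment> \<open>Without its final entry this is a closed walk of \<open>length xs\<close>
      steps, to which the girth bound applies.\<close>
    have "walk TC ((last xs # xs) @ [hd xs])" "reduced ((last xs # xs) @ [hd xs])"
      using xs by simp_all
    then have w: "walk TC (last xs # xs)" "reduced (last xs # xs)"
      by (blast dest: successively_append_iff[THEN iffD1] triples_append1)+
    then have "8 < length (last xs # xs)"
      using TC_girth[OF w] xs(1) by simp
    \<comment> \<open>At least 8 passages of at least 4 vertices in a cycle of length at most 32
      force equality, so every passage is a turn.\<close>
    then have len: "length xs = 8" and t: "triples turn (last xs # xs @ [hd xs])"
      using xs(4) tight c(2) assms(2) by auto
    \<comment> \<open>The turn at \<open>x\<close> uses the edge to its successor, which is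
      therefore adjacent to \<open>x\<close> in the closed walk.\<close>
    have "(x + 1) mod 30 \<in> set xs" if x: "x \<in> set xs" for x
    proof -
      obtain s r where sr: "s \<in> set (last xs # xs)" "r \<in> set (xs @ [hd xs])" "turn s x r"
        using triples_midpoint[OF t x] by blast
      then have "s \<in> set xs" "r \<in> set xs" using xs(1) by auto
      then show ?thesis
        using sr(3) by (auto simp: tc_orientation_def doubleton_eq_iff)
    qed
    moreover have "set xs \<subseteq> {..<30}"
    proof
      fix x assume "x \<in> set xs"
      then obtain i where "i < length xs" "x = xs ! i" by (metis in_set_conv_nth)
      then have "{(last xs # xs) ! i, x} \<in> edges TC"
        using w(1) by (auto simp: successively_conv_nth)
      then show "x \<in> {..<30}" by (auto simp: TC_edge insert_commute)
    qed
    ultimately have "set xs = {..<30}" using xs(1) by (intro successor_closed) auto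
    then have "30 \<le> length xs" by (metis card_length card_lessThan)
    then show False using len by simp
  qed
qed

theorem theorem4p2:
  shows "(\<exists>\<omega>. orientation TC \<omega> \<and>
           (\<forall>\<beta>. realises TC \<beta> \<omega> \<longrightarrow>
              cubic (H15_replacement TC \<beta>) \<and>
              card (verts (H15_replacement TC \<beta>)) = 450 \<and>
              (\<forall>n \<in> {4, 8, 16, 32}. \<not> has_cycle_of_length (H15_replacement TC \<beta>) n)))
         \<and> smallest_order 5 \<le> 450"
proof -
  have *: "cubic (H15_replacement TC \<beta>)" "card (verts (H15_replacement TC \<beta>)) = 450"
    if "realises TC \<beta> tc_orientation" for \<beta>
  proof -
    interpret replacement TC \<beta>
      using that cubic_TC by unfold_locales (auto simp: realises_def)
    show "cubic (H15_replacement TC \<beta>)" "card (verts (H15_replacement TC \<beta>)) = 450"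
      using cubic_R card_verts_R by (simp_all add: R_def verts_TC)
  qed
  \<comment> \<open>The bound on \<open>smallest_order\<close> needs an actual graph, hence an
    assignment that realises the orientation.\<close>
  obtain \<beta> where \<beta>: "realises TC \<beta> tc_orientation"
    using ex_assignment[OF cubic_TC orientation_TC] by blast
  let ?R = "H15_replacement TC \<beta>"
  have "\<not> has_cycle_of_length ?R (2 ^ m)" if "m \<le> 5" for m
  proof (cases "m \<le> 1")
    case True
    \<comment> \<open>Lengths 1 and 2 are excluded by the definition of a cycle.\<close>
    then have "(2::nat) ^ m < 3" by (cases m) auto
    then show ?thesis by (auto simp: has_cycle_of_length_def is_cycle_def)
  next
    case False
    then have "m \<in> {2, 3, 4, 5}" using that by auto
    then have "(2::nat) ^ m \<in> {4, 8, 16, 32}" by auto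
    then show ?thesis by (rule TC_replacement_no_cycle[OF \<beta>])
  qed
  moreover have "verts ?R \<noteq> {}" using *(2)[OF \<beta>] by auto
  ultimately have "smallest_order 5 \<le> 450"
    using smallest_order_le[of ?R 5] *[OF \<beta>] by simp
  then show ?thesis
    using orientation_TC * TC_replacement_no_cycle by blast
qed

end
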